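(* Hex-trees are unary-binary trees (with parameter $a=1$): the map from Hex-trees to unary-binary trees which sends $\square$ to $\square$, and which recursively regards a single node as a node with two empty subtrees, a root with two nonempty successors as a root with these two subtrees, a root with only a left (respectively right) successor as a root with two subtrees of which the right (respectively left) one is empty, and a root with a middle successor as a root with a unary branch, is a bijection preserving the number of nodes.
   Context: Hex-trees form the family $\mathscr{H}$ defined recursively: a Hex-tree is either the empty tree $\square$ (size $0$); or a single node; or a root with an ordered pair (left, right) of nonempty Hex-trees as successors; or a root with exactly one successor, a nonempty Hex-tree, which is of one of three types: left, middle or right. Unary-binary trees (parameter $a=1$) form the family $\mathscr{M}$ defined recursively: a tree in $\mathscr{M}$ is either the empty tree $\square$ (size $0$); or an internal node with an ordered pair (left, right) of subtrees in $\mathscr{M}$, possibly empty; or an internal node with a single unary branch to a nonempty tree of $\mathscr{M}$. The number of nodes of a unary-binary tree is its number of internal nodes; the empty tree $\square$ does not count as a node. *)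

theory Defs
  imports Main
begin

text \<open>
  Each family is carved out of a datatype of tree terms: the datatype alone also contains
  terms such as \<open>HLeft HEmpty\<close>, which the nonemptiness conditions in the inductive
  definitions of \<open>hex_trees\<close> and \<open>ub_trees\<close> exclude.
\<close>

datatype hex =
    HEmpty
  | HSingle
  | HBinary hex hex
  | HLeft hex
  | HMiddle hex
  | HRight hex

inductive_set hex_trees :: "hex set" where
  empty: "HEmpty \<in> hex_trees"
| single: "HSingle \<in> hex_trees"
| binary: "l \<in> hex_trees \<Longrightarrow> l \<noteq> HEmpty \<Longrightarrow> r \<in> hex_trees \<Longrightarrow> r \<noteq> HEmpty \<Longrightarrow> HBinary l r \<in> hex_trees"
| left: "t \<in> hex_trees \<Longrightarrow> t \<noteq> HEmpty \<Longrightarrow> HLeft t \<in> hex_trees"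
| middle: "t \<in> hex_trees \<Longrightarrow> t \<noteq> HEmpty \<Longrightarrow> HMiddle t \<in> hex_trees"
| right: "t \<in> hex_trees \<Longrightarrow> t \<noteq> HEmpty \<Longrightarrow> HRight t \<in> hex_trees"

primrec hex_nodes :: "hex \<Rightarrow> nat" where
  "hex_nodes HEmpty = 0"
| "hex_nodes HSingle = 1"
| "hex_nodes (HBinary l r) = 1 + hex_nodes l + hex_nodes r"
| "hex_nodes (HLeft t) = 1 + hex_nodes t"
| "hex_nodes (HMiddle t) = 1 + hex_nodes t"
| "hex_nodes (HRight t) = 1 + hex_nodes t"

text \<open>
  Unary-binary trees with parameter \<open>a = 1\<close>: there is only one kind of unary branch.
\<close>

datatype ub =
    UBEmpty
  | UBBinary ub ub
  | UBUnary ub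

inductive_set ub_trees :: "ub set" where
  empty: "UBEmpty \<in> ub_trees"
| binary: "l \<in> ub_trees \<Longrightarrow> r \<in> ub_trees \<Longrightarrow> UBBinary l r \<in> ub_trees"
| unary: "t \<in> ub_trees \<Longrightarrow> t \<noteq> UBEmpty \<Longrightarrow> UBUnary t \<in> ub_trees"

primrec ub_nodes :: "ub \<Rightarrow> nat" where
  "ub_nodes UBEmpty = 0"
| "ub_nodes (UBBinary l r) = 1 + ub_nodes l + ub_nodes r"
| "ub_nodes (UBUnary t) = 1 + ub_nodes t"

primrec hex_to_ub :: "hex \<Rightarrow> ub" where
  "hex_to_ub HEmpty = UBEmpty"
| "hex_to_ub HSingle = UBBinary UBEmpty UBEmpty"
| "hex_to_ub (HBinary l r) = UBBinary (hex_to_ub l) (hex_to_ub r)"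
| "hex_to_ub (HLeft t) = UBBinary (hex_to_ub t) UBEmpty"
| "hex_to_ub (HMiddle t) = UBUnary (hex_to_ub t)"
| "hex_to_ub (HRight t) = UBBinary UBEmpty (hex_to_ub t)"

end

theory Submission
  imports Defs
begin

text \<open>
  The two subtrees of a binary node of a unary-binary tree are either both empty, or exactly one
  of them is empty, or none is. These four cases are the images of a single node, of a root with
  only a left or only a right successor, and of a root with two successors. So the emptiness of
  the subtrees tells which Hex constructor a binary node came from, and this gives an inverse by
  recursion. The cases are disjoint because on Hex-trees the successors are nonempty and
  \<open>hex_to_ub\<close> sends no nonempty tree to \<open>UBEmpty\<close>; on arbitrary terms injectivity fails, since
  \<open>HLeft HEmpty\<close> and \<open>HSingle\<close> have the same image.
\<close>

primrec ub_to_hex :: "ub \<Rightarrow> hex" where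
  "ub_to_hex UBEmpty = HEmpty"
| "ub_to_hex (UBBinary l r) =
    (if l = UBEmpty then (if r = UBEmpty then HSingle else HRight (ub_to_hex r))
     else if r = UBEmpty then HLeft (ub_to_hex l)
     else HBinary (ub_to_hex l) (ub_to_hex r))"
| "ub_to_hex (UBUnary t) = HMiddle (ub_to_hex t)"

lemma hex_to_ub_eq_UBEmpty_iff [simp]: "hex_to_ub t = UBEmpty \<longleftrightarrow> t = HEmpty"
  by (cases t) auto

lemma ub_to_hex_eq_HEmpty_iff [simp]: "ub_to_hex u = HEmpty \<longleftrightarrow> u = UBEmpty"
  by (cases u) auto

lemma hex_to_ub_in_ub_trees: "t \<in> hex_trees \<Longrightarrow> hex_to_ub t \<in> ub_trees"
  by (induction rule: hex_trees.induct) (auto intro: ub_trees.intros)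

lemma ub_to_hex_in_hex_trees: "u \<in> ub_trees \<Longrightarrow> ub_to_hex u \<in> hex_trees"
  by (induction rule: ub_trees.induct) (auto intro: hex_trees.intros)

lemma ub_to_hex_hex_to_ub: "t \<in> hex_trees \<Longrightarrow> ub_to_hex (hex_to_ub t) = t"
  by (induction rule: hex_trees.induct) auto

lemma hex_to_ub_ub_to_hex: "hex_to_ub (ub_to_hex u) = u"
  by (induction u) auto

lemma ub_nodes_hex_to_ub: "ub_nodes (hex_to_ub t) = hex_nodes t"
  by (induction t) auto

theorem mainTheorem3:
  shows "bij_betw hex_to_ub hex_trees ub_trees
    \<and> (\<forall>t\<in>hex_trees. ub_nodes (hex_to_ub t) = hex_nodes t)"
proof
  show "bij_betw hex_to_ub hex_trees ub_trees"
    by (rule bij_betw_byWitness [where f' = ub_to_hex])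
      (auto simp: ub_to_hex_hex_to_ub hex_to_ub_ub_to_hex
        hex_to_ub_in_ub_trees ub_to_hex_in_hex_trees)
  show "\<forall>t\<in>hex_trees. ub_nodes (hex_to_ub t) = hex_nodes t"
    by (simp add: ub_nodes_hex_to_ub)
qed

end
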